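(* Let $\alpha\in(0,\pi)$ and let $n\ge 1$ be an integer. With the functions $T_{2(n+1),r}^{\alpha}$ and the recursively defined real numbers $\lambda_{k,r}^{n+1},\mu_{k,r}^{n+1}$ ($1\le k\le n+1$, $0\le r\le 2(n+1)$) given in the context, the matrix form of the linear transformation from the normalized B-basis $\{T_{2(n+1),r}^{\alpha}\}_{r=0}^{2(n+1)}$ to the canonical trigonometric basis $\{1,\sin(u),\cos(u),\ldots,\sin((n+1)u),\cos((n+1)u)\}$ is $$ \begin{bmatrix} 1\\ \sin(u)\\ \cos(u)\\ \vdots\\ \sin((n+1)u)\\ \cos((n+1)u)\end{bmatrix} = \begin{bmatrix} 1 & 1 & \cdots & 1\\ \lambda_{1,0}^{n+1} & \lambda_{1,1}^{n+1} & \cdots & \lambda_{1,2(n+1)}^{n+1}\\ \mu_{1,0}^{n+1} & \mu_{1,1}^{n+1} & \cdots & \mu_{1,2(n+1)}^{n+1}\\ \vdots & \vdots & & \vdots\\ \lambda_{n+1,0}^{n+1} & \lambda_{n+1,1}^{n+1} & \cdots & \lambda_{n+1,2(n+1)}^{n+1}\\ \mu_{n+1,0}^{n+1} & \mu_{n+1,1}^{n+1} & \cdots & \mu_{n+1,2(n+1)}^{n+1} \end{bmatrix} \begin{bmatrix} T_{2(n+1),0}^{\alpha}(u)\\ T_{2(n+1),1}^{\alpha}(u)\\ \vdots\\ T_{2(n+1),2(n+1)}^{\alpha}(u)\end{bmatrix} $$ for all $u\in[0,\alpha]$. That is, for all $u\in[0,\alpha]$: $1=\sum_{r=0}^{2(n+1)}T_{2(n+1),r}^{\alpha}(u)$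 and, for every $k=1,\ldots,n+1$, $\sin(ku)=\sum_{r=0}^{2(n+1)}\lambda_{k,r}^{n+1}T_{2(n+1),r}^{\alpha}(u)$ and $\cos(ku)=\sum_{r=0}^{2(n+1)}\mu_{k,r}^{n+1}T_{2(n+1),r}^{\alpha}(u)$.
   Context: For an integer $m\ge1$ and $\alpha\in(0,\pi)$, the normalized B-basis of order $m$ of $\operatorname{span}\{\cos(ku),\sin(ku):u\in[0,\alpha]\}_{k=0}^{m}$ consists of the functions $$T_{2m,i}^{\alpha}(u)=t_{2m,i}^{\alpha}\,\sin^{2m-i}\!\left(\tfrac{\alpha-u}{2}\right)\sin^{i}\!\left(\tfrac{u}{2}\right),\quad u\in[0,\alpha],\ i=0,1,\ldots,2m,$$ where $$t_{2m,i}^{\alpha}=\frac{1}{\sin^{2m}(\alpha/2)}\sum_{r=0}^{\lfloor i/2\rfloor}\binom{m}{i-r}\binom{i-r}{r}\left(2\cos(\alpha/2)\right)^{i-2r}.$$ The numbers $\lambda_{k,r}^{m},\mu_{k,r}^{m}$ ($m\ge 1$, $1\le k\le m$, $0\le r\le 2m$) are defined recursively in $m$. Initial conditions ($m=1$): $\lambda_{1,0}^{1}=0$, $\lambda_{1,1}^{1}=\tan(\alpha/2)$, $\lambda_{1,2}^{1}=\sin(\alpha)$; $\mu_{1,0}^{1}=\mu_{1,1}^{1}=1$, $\mu_{1,2}^{1}=\cos(\alpha)$. Step from $m$ to $m+1$ ($m\ge1$). For $1\le r\le 2m+1$ and $j\in\{0,1,2\}$ with $0\le r-j\le 2m$ put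 $\tau^{m}_{r,j}=\dfrac{t_{2m,r-j}^{\alpha}\,t_{2,j}^{\alpha}}{t_{2(m+1),r}^{\alpha}}$. Below, $\sum_j$ denotes summation over all $j\in\{0,1,2\}$ with $0\le r-j\le 2m$. (i) For $1\le k\le m$: $\lambda_{k,0}^{m+1}=\lambda_{k,0}^{m}$, $\lambda_{k,2(m+1)}^{m+1}=\lambda_{k,2m}^{m}$, and $\lambda_{k,r}^{m+1}=\sum_j \lambda_{k,r-j}^{m}\tau^m_{r,j}$ for $1\le r\le 2m+1$; likewise $\mu_{k,0}^{m+1}=\mu_{k,0}^{m}$, $\mu_{k,2(m+1)}^{m+1}=\mu_{k,2m}^{m}$, and $\mu_{k,r}^{m+1}=\sum_j \mu_{k,r-j}^{m}\tau^m_{r,j}$ for $1\le r\le 2m+1$. (ii) For $k=m+1$: $\lambda_{m+1,0}^{m+1}=\lambda_{m,0}^{m}\mu_{1,0}^{1}+\mu_{m,0}^{m}\lambda_{1,0}^{1}$, $\ \lambda_{m+1,2(m+1)}^{m+1}=\lambda_{m,2m}^{m}\mu_{1,2}^{1}+\mu_{m,2m}^{m}\lambda_{1,2}^{1}$, $\ \lambda_{m+1,r}^{m+1}=\sum_j\left(\lambda_{m,r-j}^{m}\mu_{1,j}^{1}+\mu_{m,r-j}^{m}\lambda_{1,j}^{1}\right)\tau^m_{r,j}$ for $1\le r\le 2m+1$; $\mu_{m+1,0}^{m+1}=\mu_{m,0}^{m}\mu_{1,0}^{1}-\lambda_{m,0}^{m}\lambda_{1,0}^{1}$, $\ \mu_{m+1,2(m+1)}^{m+1}=\mu_{m,2m}^{m}\mu_{1,2}^{1}-\lambda_{m,2m}^{m}\lambda_{1,2}^{1}$,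 $\ \mu_{m+1,r}^{m+1}=\sum_j\left(\mu_{m,r-j}^{m}\mu_{1,j}^{1}-\lambda_{m,r-j}^{m}\lambda_{1,j}^{1}\right)\tau^m_{r,j}$ for $1\le r\le 2m+1$. *)

theory Defs
  imports Complex_Main "Jordan_Normal_Form.Matrix"
begin

text \<open>The order \<open>m\<close> is the second argument throughout: \<open>B_norm \<alpha> m i\<close> is
  $t_{2m,i}^{\alpha}$ and \<open>B_fun \<alpha> m i\<close> is $T_{2m,i}^{\alpha}$, so that \<open>i\<close> ranges over
  \<open>0..2 * m\<close> and the truncated subtraction \<open>2 * m - i\<close> is exact.\<close>

definition B_norm :: "real \<Rightarrow> nat \<Rightarrow> nat \<Rightarrow> real" where
  "B_norm \<alpha> m i = 1 / sin (\<alpha> / 2) ^ (2 * m) *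
     (\<Sum>r = 0..i div 2. real (m choose (i - r)) * real ((i - r) choose r) *
        (2 * cos (\<alpha> / 2)) ^ (i - 2 * r))"

definition B_fun :: "real \<Rightarrow> nat \<Rightarrow> nat \<Rightarrow> real \<Rightarrow> real" where
  "B_fun \<alpha> m i u = B_norm \<alpha> m i * sin ((\<alpha> - u) / 2) ^ (2 * m - i) * sin (u / 2) ^ i"

definition tau :: "real \<Rightarrow> nat \<Rightarrow> nat \<Rightarrow> nat \<Rightarrow> real" where
  "tau \<alpha> m r j = B_norm \<alpha> m (r - j) * B_norm \<alpha> 1 j / B_norm \<alpha> (m + 1) r"

text \<open>The indices \<open>j \<in> {0, 1, 2}\<close> with $0 \le r - j \le 2m$.\<close>

definition step_indices :: "nat \<Rightarrow> nat \<Rightarrow> nat set" where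
  "step_indices m r = {j. j \<le> 2 \<and> j \<le> r \<and> r - j \<le> 2 * m}"

text \<open>\<open>lam \<alpha> m k r\<close> and \<open>mu \<alpha> m k r\<close> are $\lambda_{k,r}^{m}$ and $\mu_{k,r}^{m}$. They are
  meaningful for \<open>1 \<le> k \<le> m\<close> and \<open>r \<le> 2 * m\<close>; elsewhere they are set to \<open>0\<close>. In the last
  equation of each function, \<open>Suc p\<close> is the order $m \ge 1$ from which the step to $m + 1$ is
  taken.\<close>

fun lam mu :: "real \<Rightarrow> nat \<Rightarrow> nat \<Rightarrow> nat \<Rightarrow> real" where
  "lam \<alpha> 0 k r = 0"
| "lam \<alpha> (Suc 0) k r =
     (if k \<noteq> 1 then 0
      else if r = 0 then 0
      else if r = 1 then tan (\<alpha> / 2)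
      else if r = 2 then sin \<alpha>
      else 0)"
| "lam \<alpha> (Suc (Suc p)) k r =
     (if k < 1 \<or> k > Suc p + 1 \<or> r > 2 * (Suc p + 1) then 0
      else if k \<le> Suc p then
        (if r = 0 then lam \<alpha> (Suc p) k 0
         else if r = 2 * (Suc p + 1) then lam \<alpha> (Suc p) k (2 * Suc p)
         else (\<Sum>j\<in>step_indices (Suc p) r. lam \<alpha> (Suc p) k (r - j) * tau \<alpha> (Suc p) r j))
      else
        (if r = 0 then
           lam \<alpha> (Suc p) (Suc p) 0 * mu \<alpha> (Suc 0) 1 0 +
           mu \<alpha> (Suc p) (Suc p) 0 * lam \<alpha> (Suc 0) 1 0
         else if r = 2 * (Suc p + 1) then
           lam \<alpha> (Suc p) (Suc p) (2 * Suc p) * mu \<alpha> (Suc 0) 1 2 +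
           mu \<alpha> (Suc p) (Suc p) (2 * Suc p) * lam \<alpha> (Suc 0) 1 2
         else
           (\<Sum>j\<in>step_indices (Suc p) r.
              (lam \<alpha> (Suc p) (Suc p) (r - j) * mu \<alpha> (Suc 0) 1 j +
               mu \<alpha> (Suc p) (Suc p) (r - j) * lam \<alpha> (Suc 0) 1 j) * tau \<alpha> (Suc p) r j)))"
| "mu \<alpha> 0 k r = 0"
| "mu \<alpha> (Suc 0) k r =
     (if k \<noteq> 1 then 0
      else if r = 0 then 1
      else if r = 1 then 1
      else if r = 2 then cos \<alpha>
      else 0)"
| "mu \<alpha> (Suc (Suc p)) k r =
     (if k < 1 \<or> k > Suc p + 1 \<or> r > 2 * (Suc p + 1) then 0
      else if k \<le> Suc p then
        (if r = 0 then mu \<alpha> (Suc p) k 0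
         else if r = 2 * (Suc p + 1) then mu \<alpha> (Suc p) k (2 * Suc p)
         else (\<Sum>j\<in>step_indices (Suc p) r. mu \<alpha> (Suc p) k (r - j) * tau \<alpha> (Suc p) r j))
      else
        (if r = 0 then
           mu \<alpha> (Suc p) (Suc p) 0 * mu \<alpha> (Suc 0) 1 0 -
           lam \<alpha> (Suc p) (Suc p) 0 * lam \<alpha> (Suc 0) 1 0
         else if r = 2 * (Suc p + 1) then
           mu \<alpha> (Suc p) (Suc p) (2 * Suc p) * mu \<alpha> (Suc 0) 1 2 -
           lam \<alpha> (Suc p) (Suc p) (2 * Suc p) * lam \<alpha> (Suc 0) 1 2
         else
           (\<Sum>j\<in>step_indices (Suc p) r.
              (mu \<alpha> (Suc p) (Suc p) (r - j) * mu \<alpha> (Suc 0) 1 j -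
               lam \<alpha> (Suc p) (Suc p) (r - j) * lam \<alpha> (Suc 0) 1 j) * tau \<alpha> (Suc p) r j)))"

text \<open>Rows are numbered from \<open>0\<close>: row \<open>0\<close> belongs to the constant \<open>1\<close>, row \<open>2 * k - 1\<close> to
  $\sin(ku)$ and row \<open>2 * k\<close> to $\cos(ku)$, for \<open>1 \<le> k \<le> m\<close>.\<close>

definition trig_vec :: "nat \<Rightarrow> real \<Rightarrow> real vec" where
  "trig_vec m u = vec (2 * m + 1) (\<lambda>i.
     if i = 0 then 1
     else if odd i then sin (real ((i + 1) div 2) * u)
     else cos (real (i div 2) * u))"

definition B_vec :: "real \<Rightarrow> nat \<Rightarrow> real \<Rightarrow> real vec" where
  "B_vec \<alpha> m u = vec (2 * m + 1) (\<lambda>r. B_fun \<alpha> m r u)"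

definition trafo_mat :: "real \<Rightarrow> nat \<Rightarrow> real mat" where
  "trafo_mat \<alpha> m = mat (2 * m + 1) (2 * m + 1) (\<lambda>(i, r).
     if i = 0 then 1
     else if odd i then lam \<alpha> m ((i + 1) div 2) r
     else mu \<alpha> m (i div 2) r)"

end

theory Submission
  imports Defs
begin

text \<open>
  Write \<open>s = sin (\<alpha> / 2)\<close>, \<open>c = cos (\<alpha> / 2)\<close>, \<open>x = sin ((\<alpha> - u) / 2)\<close> and \<open>y = sin (u / 2)\<close>.
  The numbers \<open>s ^ (2 * m) * B_norm \<alpha> m i\<close> are the coefficients of the \<open>m\<close>-th power of the
  trinomial \<open>x\<^sup>2 + 2 * c * x * y + y\<^sup>2\<close> (lemma \<open>trinomial_power\<close>), and the addition theorem says that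
  this trinomial is equal to \<open>s\<^sup>2\<close>. Hence the functions \<open>B_fun \<alpha> m i\<close> form a partition of unity.

  Since the exponents add up, the product of the \<open>i\<close>-th basis function of order \<open>m\<close> and the
  \<open>j\<close>-th one of order \<open>1\<close> is \<open>tau \<alpha> m (i + j) j\<close> times the \<open>(i + j)\<close>-th one of order \<open>m + 1\<close>.
  So a product of two expansions, of orders \<open>m\<close> and \<open>1\<close>, is an expansion of order \<open>m + 1\<close>, whose
  coefficients are a convolution weighted by \<open>tau\<close> (lemma \<open>B_expansion_mult\<close>). The recursion
  for \<open>lam\<close> and \<open>mu\<close> consists of such convolutions: for \<open>k \<le> m\<close> the expansions of
  \<open>sin (k u)\<close> and \<open>cos (k u)\<close> are multiplied by that of the constant \<open>1\<close> (degree elevation), and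
  for \<open>k = m + 1\<close> the expansions for \<open>m u\<close> and \<open>u\<close> are combined by the addition theorems. The
  two boundary coefficients fit the same pattern because \<open>tau\<close> equals \<open>1\<close> there. The claim follows
  by induction on \<open>m\<close>, the order \<open>1\<close> being an explicit computation.
\<close>

section \<open>The normalizing constants\<close>

lemma B_norm_pos:
  assumes "0 < \<alpha>" "\<alpha> < pi" "i \<le> 2 * m"
  shows "B_norm \<alpha> m i > 0"
proof -
  have s: "sin (\<alpha> / 2) > 0" and c: "cos (\<alpha> / 2) > 0"
    using assms by (auto intro!: sin_gt_zero cos_gt_zero)
  have "(\<Sum>r = 0..i div 2. real (m choose (i - r)) * real ((i - r) choose r) *
          (2 * cos (\<alpha> / 2)) ^ (i - 2 * r)) > 0"
  proof (rule sum_pos2)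
    \<comment> \<open>The largest summation index makes both binomial coefficients nonzero.\<close>
    show "i div 2 \<in> {0..i div 2}" by simp
    have "i - i div 2 \<le> m" "i div 2 \<le> i - i div 2" using assms(3) by linarith+
    then show "0 < real (m choose (i - i div 2)) * real ((i - i div 2) choose (i div 2)) *
        (2 * cos (\<alpha> / 2)) ^ (i - 2 * (i div 2))"
      using c by (simp add: zero_less_binomial_iff)
  qed (use c in simp_all)
  then show ?thesis using s by (simp add: B_norm_def)
qed

lemma B_norm_first: "B_norm \<alpha> m 0 = 1 / sin (\<alpha> / 2) ^ (2 * m)"
  by (simp add: B_norm_def)

lemma B_norm_last: "B_norm \<alpha> m (2 * m) = 1 / sin (\<alpha> / 2) ^ (2 * m)"
proof -
  have "(\<Sum>r = 0..m. real (m choose (2 * m - r)) * real ((2 * m - r) choose r) *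
          (2 * cos (\<alpha> / 2)) ^ (2 * m - 2 * r))
      = (\<Sum>r = 0..m. if r = m then 1 else 0)"
    by (rule sum.cong) (auto simp: binomial_eq_0)
  then show ?thesis by (simp add: B_norm_def)
qed

lemma B_norm_1_1: "B_norm \<alpha> 1 1 = 2 * cos (\<alpha> / 2) / sin (\<alpha> / 2) ^ 2"
  by (simp add: B_norm_def)

section \<open>Partition of unity\<close>

text \<open>The left-hand side is expanded with the binomial theorem twice; the term belonging to \<open>q\<close> and
  \<open>r\<close> contributes to the power \<open>y ^ (q + r)\<close>.\<close>

lemma trinomial_power:
  fixes x y d :: "'a :: comm_semiring_1"
  shows "(x\<^sup>2 + d * x * y + y\<^sup>2) ^ m =
    (\<Sum>i = 0..2 * m. (\<Sum>r = 0..i div 2. of_nat (m choose (i - r)) * of_nat ((i - r) choose r) *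
       d ^ (i - 2 * r)) * x ^ (2 * m - i) * y ^ i)"
proof -
  let ?f = "\<lambda>q r. of_nat (m choose q) * of_nat (q choose r) * d ^ (q - r) *
    x ^ (2 * m - (q + r)) * y ^ (q + r)"
  have "(x\<^sup>2 + d * x * y + y\<^sup>2) ^ m = (y * (y + d * x) + x\<^sup>2) ^ m"
    by (simp add: algebra_simps power2_eq_square)
  also have "\<dots> = (\<Sum>q\<le>m. of_nat (m choose q) * (y * (y + d * x)) ^ q * (x\<^sup>2) ^ (m - q))"
    by (rule binomial_ring)
  also have "\<dots> = (\<Sum>q\<le>m. \<Sum>r\<le>q. ?f q r)"
  proof (rule sum.cong[OF refl])
    fix q assume "q \<in> {..m}"
    then have q: "q \<le> m" by simp
    have "of_nat (m choose q) * (y * (y + d * x)) ^ q * (x\<^sup>2) ^ (m - q) =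
      (\<Sum>r\<le>q. of_nat (m choose q) * (y ^ q * (of_nat (q choose r) * y ^ r * (d * x) ^ (q - r))) *
         x ^ (2 * (m - q)))"
      by (simp add: power_mult_distrib binomial_ring power_mult sum_distrib_left sum_distrib_right)
    also have "\<dots> = (\<Sum>r\<le>q. ?f q r)"
    proof (rule sum.cong[OF refl])
      fix r assume "r \<in> {..q}"
      then have "2 * m - (q + r) = (q - r) + 2 * (m - q)" using q by simp
      then have "x ^ (2 * m - (q + r)) = x ^ (q - r) * x ^ (2 * (m - q))"
        by (simp only: power_add)
      then show "of_nat (m choose q) * (y ^ q * (of_nat (q choose r) * y ^ r * (d * x) ^ (q - r))) *
         x ^ (2 * (m - q)) = ?f q r"
        by (simp add: power_mult_distrib power_add mult_ac)
    qed
    finally show "of_nat (m choose q) * (y * (y + d * x)) ^ q * (x\<^sup>2) ^ (m - q) =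
      (\<Sum>r\<le>q. ?f q r)" .
  qed
  also have "\<dots> = (\<Sum>(q, r)\<in>Sigma {..m} (\<lambda>q. {..q}). ?f q r)"
    by (simp add: sum.Sigma)
  also have "\<dots> = (\<Sum>(i, r)\<in>Sigma {0..2 * m} (\<lambda>i. {0..i div 2}). ?f (i - r) r)"
    \<comment> \<open>Index pairs on the right with \<open>i - r > m\<close> have no partner, but their terms vanish.\<close>
    by (rule sum.reindex_bij_witness_not_neutral[where S' = "{}" and
          T' = "{(i, r) \<in> Sigma {0..2 * m} (\<lambda>i. {0..i div 2}). i - r > m}" and
          i = "\<lambda>(i, r). (i - r, r)" and j = "\<lambda>(q, r). (q + r, r)"])
      (auto simp: binomial_eq_0 intro: finite_subset[of _ "{0..2 * m} \<times> {0..2 * m}"])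
  also have "\<dots> = (\<Sum>i = 0..2 * m. \<Sum>r = 0..i div 2. ?f (i - r) r)"
    by (subst sum.Sigma) simp_all
  also have "\<dots> = (\<Sum>i = 0..2 * m. (\<Sum>r = 0..i div 2. of_nat (m choose (i - r)) *
      of_nat ((i - r) choose r) * d ^ (i - 2 * r)) * x ^ (2 * m - i) * y ^ i)"
    unfolding sum_distrib_right
  proof (intro sum.cong refl)
    fix i r :: nat assume "r \<in> {0..i div 2}"
    then have "i - r + r = i" "i - r - r = i - 2 * r" by auto
    then show "?f (i - r) r = of_nat (m choose (i - r)) * of_nat ((i - r) choose r) *
        d ^ (i - 2 * r) * x ^ (2 * m - i) * y ^ i" by simp
  qed
  finally show ?thesis .
qed

lemma half_angle_trinomial:
  fixes \<alpha> u :: real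
  shows "sin ((\<alpha> - u) / 2) ^ 2 + 2 * cos (\<alpha> / 2) * sin ((\<alpha> - u) / 2) * sin (u / 2)
    + sin (u / 2) ^ 2 = sin (\<alpha> / 2) ^ 2"
proof -
  have "sin ((\<alpha> - u) / 2) = sin (\<alpha> / 2) * cos (u / 2) - cos (\<alpha> / 2) * sin (u / 2)"
    by (simp add: diff_divide_distrib sin_diff)
  moreover have "(s * C - c * S)\<^sup>2 + 2 * c * (s * C - c * S) * S + S\<^sup>2 = s\<^sup>2"
    if "s\<^sup>2 + c\<^sup>2 = 1" "S\<^sup>2 + C\<^sup>2 = 1" for s c S C :: real
  proof -
    have "(s * C - c * S)\<^sup>2 + 2 * c * (s * C - c * S) * S + S\<^sup>2 = s\<^sup>2 * C\<^sup>2 + (1 - c\<^sup>2) * S\<^sup>2"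
      by (simp add: power2_eq_square algebra_simps)
    also have "1 - c\<^sup>2 = s\<^sup>2" using that(1) by simp
    also have "s\<^sup>2 * C\<^sup>2 + s\<^sup>2 * S\<^sup>2 = s\<^sup>2 * (S\<^sup>2 + C\<^sup>2)" by (simp add: distrib_left)
    finally show ?thesis using that(2) by simp
  qed
  ultimately show ?thesis by simp
qed

lemma B_fun_sum_eq_1:
  assumes "0 < \<alpha>" "\<alpha> < pi"
  shows "(\<Sum>i = 0..2 * m. B_fun \<alpha> m i u) = 1"
proof -
  have s: "sin (\<alpha> / 2) > 0" using assms by (auto intro!: sin_gt_zero)
  have "(\<Sum>i = 0..2 * m. B_fun \<alpha> m i u) = 1 / sin (\<alpha> / 2) ^ (2 * m) *
    (sin ((\<alpha> - u) / 2) ^ 2 + 2 * cos (\<alpha> / 2) * sin ((\<alpha> - u) / 2) * sin (u / 2)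
      + sin (u / 2) ^ 2) ^ m"
    unfolding trinomial_power sum_distrib_left[of "1 / _"]
    by (rule sum.cong) (simp_all add: B_fun_def B_norm_def mult.assoc)
  also have "\<dots> = 1" using s by (simp add: half_angle_trinomial power_mult)
  finally show ?thesis .
qed

section \<open>Products of expansions\<close>

lemma B_fun_mult:
  assumes "0 < \<alpha>" "\<alpha> < pi" "i \<le> 2 * m" "j \<le> 2"
  shows "B_fun \<alpha> m i u * B_fun \<alpha> 1 j u = tau \<alpha> m (i + j) j * B_fun \<alpha> (m + 1) (i + j) u"
proof -
  have "2 * (m + 1) - (i + j) = (2 * m - i) + (2 - j)" using assms by simp
  moreover have "B_norm \<alpha> (m + 1) (i + j) > 0" using assms by (intro B_norm_pos) auto
  ultimately show ?thesis by (simp add: B_fun_def tau_def power_add mult_ac)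
qed

text \<open>The coefficients of the product of an expansion of order \<open>m\<close> with coefficients \<open>f\<close> and an
  expansion of order \<open>1\<close> with coefficients \<open>g\<close>, with respect to the basis of order \<open>m + 1\<close>.\<close>

definition B_conv :: "real \<Rightarrow> nat \<Rightarrow> (nat \<Rightarrow> real) \<Rightarrow> (nat \<Rightarrow> real) \<Rightarrow> nat \<Rightarrow> real" where
  "B_conv \<alpha> m f g r = (\<Sum>j\<in>step_indices m r. f (r - j) * g j * tau \<alpha> m r j)"

lemma finite_step_indices: "finite (step_indices m r)"
  by (rule finite_subset[of _ "{..2}"]) (auto simp: step_indices_def)

lemma B_expansion_mult:
  assumes "0 < \<alpha>" "\<alpha> < pi"
  shows "(\<Sum>i = 0..2 * m. f i * B_fun \<alpha> m i u) * (\<Sum>j = 0..2. g j * B_fun \<alpha> 1 j u) =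
    (\<Sum>r = 0..2 * (m + 1). B_conv \<alpha> m f g r * B_fun \<alpha> (m + 1) r u)"
proof -
  have "(\<Sum>i = 0..2 * m. f i * B_fun \<alpha> m i u) * (\<Sum>j = 0..2. g j * B_fun \<alpha> 1 j u) =
    (\<Sum>(i, j)\<in>{0..2 * m} \<times> {0..2}. f i * g j * (B_fun \<alpha> m i u * B_fun \<alpha> 1 j u))"
    unfolding sum_product sum.cartesian_product by (intro sum.cong refl) (auto simp: mult_ac)
  also have "\<dots> = (\<Sum>(i, j)\<in>{0..2 * m} \<times> {0..2}.
      f i * g j * tau \<alpha> m (i + j) j * B_fun \<alpha> (m + 1) (i + j) u)"
    using B_fun_mult[OF assms] by (intro sum.cong refl) (auto simp: mult.assoc)
  also have "\<dots> = (\<Sum>(r, j)\<in>Sigma {0..2 * (m + 1)} (step_indices m).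
      f (r - j) * g j * tau \<alpha> m r j * B_fun \<alpha> (m + 1) r u)"
    by (rule sum.reindex_bij_witness[where i = "\<lambda>(r, j). (r - j, j)" and
          j = "\<lambda>(i, j). (i + j, j)"]) (auto simp: step_indices_def)
  also have "\<dots> = (\<Sum>r = 0..2 * (m + 1). B_conv \<alpha> m f g r * B_fun \<alpha> (m + 1) r u)"
    by (subst sum.Sigma[symmetric]) (auto simp: B_conv_def sum_distrib_right finite_step_indices)
  finally show ?thesis .
qed

lemma B_conv_first:
  assumes "0 < \<alpha>" "\<alpha> < pi"
  shows "B_conv \<alpha> m f g 0 = f 0 * g 0"
proof -
  have s: "sin (\<alpha> / 2) > 0" using assms by (auto intro!: sin_gt_zero)
  have "step_indices m 0 = {0}" by (auto simp: step_indices_def)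
  moreover have "tau \<alpha> m 0 0 = 1"
    unfolding tau_def diff_0_eq_0 B_norm_first using s by (simp flip: power_add)
  ultimately show ?thesis by (simp add: B_conv_def)
qed

lemma B_conv_last:
  assumes "0 < \<alpha>" "\<alpha> < pi"
  shows "B_conv \<alpha> m f g (2 * (m + 1)) = f (2 * m) * g 2"
proof -
  have s: "sin (\<alpha> / 2) > 0" using assms by (auto intro!: sin_gt_zero)
  have "step_indices m (2 * (m + 1)) = {2}" by (auto simp: step_indices_def)
  moreover have "tau \<alpha> m (2 * (m + 1)) 2 = 1"
    using s B_norm_last[of \<alpha> m] B_norm_last[of \<alpha> 1] B_norm_last[of \<alpha> "m + 1"]
    by (simp add: tau_def power2_eq_square)
  ultimately show ?thesis by (simp add: B_conv_def)
qed

section \<open>The recursion as a convolution\<close>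

lemma lam_mu_step_le:
  assumes "0 < \<alpha>" "\<alpha> < pi" "m \<ge> 1" "1 \<le> k" "k \<le> m" "r \<le> 2 * (m + 1)"
  shows "lam \<alpha> (m + 1) k r = B_conv \<alpha> m (lam \<alpha> m k) (\<lambda>_. 1) r"
    and "mu \<alpha> (m + 1) k r = B_conv \<alpha> m (mu \<alpha> m k) (\<lambda>_. 1) r"
proof -
  obtain p where m: "m = Suc p" using assms(3) by (cases m) auto
  consider "r = 0" | "r = 2 * (m + 1)" | "r \<noteq> 0" "r \<noteq> 2 * (m + 1)" by blast
  note c = this
  show "lam \<alpha> (m + 1) k r = B_conv \<alpha> m (lam \<alpha> m k) (\<lambda>_. 1) r"
    using c
  proof cases
    case 1
    then show ?thesis
      unfolding 1 B_conv_first[OF assms(1,2)] using assms by (simp add: m)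
  next
    case 2
    then show ?thesis
      unfolding 2 B_conv_last[OF assms(1,2)] using assms by (simp add: m)
  next
    case 3
    then show ?thesis using assms by (simp add: m B_conv_def)
  qed
  show "mu \<alpha> (m + 1) k r = B_conv \<alpha> m (mu \<alpha> m k) (\<lambda>_. 1) r"
    using c
  proof cases
    case 1
    then show ?thesis
      unfolding 1 B_conv_first[OF assms(1,2)] using assms by (simp add: m)
  next
    case 2
    then show ?thesis
      unfolding 2 B_conv_last[OF assms(1,2)] using assms by (simp add: m)
  next
    case 3
    then show ?thesis using assms by (simp add: m B_conv_def)
  qed
qed

lemma lam_mu_step_top:
  assumes "0 < \<alpha>" "\<alpha> < pi" "m \<ge> 1" "r \<le> 2 * (m + 1)"
  shows "lam \<alpha> (m + 1) (m + 1) r =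
      B_conv \<alpha> m (lam \<alpha> m m) (mu \<alpha> 1 1) r + B_conv \<alpha> m (mu \<alpha> m m) (lam \<alpha> 1 1) r"
    and "mu \<alpha> (m + 1) (m + 1) r =
      B_conv \<alpha> m (mu \<alpha> m m) (mu \<alpha> 1 1) r - B_conv \<alpha> m (lam \<alpha> m m) (lam \<alpha> 1 1) r"
proof -
  obtain p where m: "m = Suc p" using assms(3) by (cases m) auto
  consider "r = 0" | "r = 2 * (m + 1)" | "r \<noteq> 0" "r \<noteq> 2 * (m + 1)" by blast
  note c = this
  show "lam \<alpha> (m + 1) (m + 1) r =
      B_conv \<alpha> m (lam \<alpha> m m) (mu \<alpha> 1 1) r + B_conv \<alpha> m (mu \<alpha> m m) (lam \<alpha> 1 1) r"
    using c
  proof cases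
    case 1
    then show ?thesis
      unfolding 1 B_conv_first[OF assms(1,2)] using assms by (simp add: m)
  next
    case 2
    then show ?thesis
      unfolding 2 B_conv_last[OF assms(1,2)] using assms by (simp add: m)
  next
    case 3
    then show ?thesis using assms
      by (simp add: m B_conv_def distrib_right sum.distrib del: lam.simps(2) mu.simps(2))
  qed
  show "mu \<alpha> (m + 1) (m + 1) r =
      B_conv \<alpha> m (mu \<alpha> m m) (mu \<alpha> 1 1) r - B_conv \<alpha> m (lam \<alpha> m m) (lam \<alpha> 1 1) r"
    using c
  proof cases
    case 1
    then show ?thesis
      unfolding 1 B_conv_first[OF assms(1,2)] using assms by (simp add: m)
  next
    case 2
    then show ?thesis
      unfolding 2 B_conv_last[OF assms(1,2)] using assms by (simp add: m)
  next
    case 3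
    then show ?thesis using assms
      by (simp add: m B_conv_def left_diff_distrib sum_subtractf del: lam.simps(2) mu.simps(2))
  qed
qed

section \<open>Expansions of the trigonometric functions\<close>

lemma trig_expansion_1:
  assumes "0 < \<alpha>" "\<alpha> < pi"
  shows "sin u = (\<Sum>j = 0..2. lam \<alpha> 1 1 j * B_fun \<alpha> 1 j u)"
    and "cos u = (\<Sum>j = 0..2. mu \<alpha> 1 1 j * B_fun \<alpha> 1 j u)"
proof -
  define s c x y where "s = sin (\<alpha> / 2)" and "c = cos (\<alpha> / 2)"
    and "x = sin ((\<alpha> - u) / 2)" and "y = sin (u / 2)"
  have s: "s > 0" and c: "c > 0"
    using assms by (auto intro!: sin_gt_zero cos_gt_zero simp: s_def c_def)
  have x: "x = s * cos (u / 2) - c * y"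
    by (simp add: s_def c_def x_def y_def diff_divide_distrib sin_diff)
  have sin\<alpha>: "sin \<alpha> = 2 * s * c" and cos\<alpha>: "cos \<alpha> = 1 - 2 * s\<^sup>2"
    using sin_double[of "\<alpha> / 2"] cos_double_sin[of "\<alpha> / 2"] by (simp_all add: s_def c_def)
  have sinu: "sin u = 2 * y * cos (u / 2)" and cosu: "cos u = 1 - 2 * y\<^sup>2"
    using sin_double[of "u / 2"] cos_double_sin[of "u / 2"] by (simp_all add: y_def)
  have B0: "B_fun \<alpha> 1 0 u = x\<^sup>2 / s\<^sup>2" and B1: "B_fun \<alpha> 1 1 u = 2 * c * x * y / s\<^sup>2"
    and B2: "B_fun \<alpha> 1 2 u = y\<^sup>2 / s\<^sup>2"
    using B_norm_first[of \<alpha> 1] B_norm_1_1[of \<alpha>] B_norm_last[of \<alpha> 1]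
    by (simp_all add: B_fun_def s_def c_def x_def y_def)
  have expand: "(\<Sum>j = 0..2. h j) = h 0 + h 1 + h 2" for h :: "nat \<Rightarrow> real"
    by (simp add: numeral_2_eq_2)
  have "(\<Sum>j = 0..2. lam \<alpha> 1 1 j * B_fun \<alpha> 1 j u) =
      s / c * (2 * c * x * y / s\<^sup>2) + sin \<alpha> * (y\<^sup>2 / s\<^sup>2)"
    unfolding expand B0 B1 B2 by (simp add: tan_def s_def c_def)
  also have "\<dots> = 2 * y * (x + c * y) / s"
    using s c by (simp add: sin\<alpha> field_simps power2_eq_square)
  also have "\<dots> = sin u" using s by (simp add: x sinu)
  finally show "sin u = (\<Sum>j = 0..2. lam \<alpha> 1 1 j * B_fun \<alpha> 1 j u)" ..
  have "(\<Sum>j = 0..2. mu \<alpha> 1 1 j * B_fun \<alpha> 1 j u) =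
      x\<^sup>2 / s\<^sup>2 + 2 * c * x * y / s\<^sup>2 + cos \<alpha> * (y\<^sup>2 / s\<^sup>2)"
    unfolding expand B0 B1 B2 by simp
  also have "\<dots> = (x\<^sup>2 + 2 * c * x * y + y\<^sup>2) / s\<^sup>2 - 2 * y\<^sup>2"
    using s by (simp add: cos\<alpha> field_simps)
  also have "\<dots> = cos u"
    using s half_angle_trinomial[of \<alpha> u] by (simp add: cosu s_def c_def x_def y_def)
  finally show "cos u = (\<Sum>j = 0..2. mu \<alpha> 1 1 j * B_fun \<alpha> 1 j u)" ..
qed

text \<open>The angle \<open>u\<close> is arbitrary: neither the partition of unity nor the addition theorems need
  \<open>0 \<le> u \<le> \<alpha>\<close>.\<close>

lemma trig_expansion:
  assumes "0 < \<alpha>" "\<alpha> < pi" "m \<ge> 1" "1 \<le> k" "k \<le> m"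
  shows "sin (real k * u) = (\<Sum>r = 0..2 * m. lam \<alpha> m k r * B_fun \<alpha> m r u) \<and>
    cos (real k * u) = (\<Sum>r = 0..2 * m. mu \<alpha> m k r * B_fun \<alpha> m r u)"
  using assms(3-5)
proof (induction m arbitrary: k rule: nat_induct_at_least)
  case base
  then have "k = 1" by simp
  then show ?case
    using trig_expansion_1[OF assms(1,2), of u] by (simp del: lam.simps mu.simps)
next
  case (Suc m)
  note mult = B_expansion_mult[OF assms(1,2), where m = m and u = u]
  have one: "(\<Sum>j = 0..2. 1 * B_fun \<alpha> 1 j u) = 1"
    using B_fun_sum_eq_1[OF assms(1,2), of 1 u] by simp
  show ?case
  proof (cases "k \<le> m")
    case True
    note step = lam_mu_step_le[OF assms(1,2) Suc.hyps Suc.prems(1) True]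
    note IH = Suc.IH[OF Suc.prems(1) True]
    have "(\<Sum>r = 0..2 * (m + 1). lam \<alpha> (m + 1) k r * B_fun \<alpha> (m + 1) r u) =
        (\<Sum>r = 0..2 * (m + 1). B_conv \<alpha> m (lam \<alpha> m k) (\<lambda>_. 1) r * B_fun \<alpha> (m + 1) r u)"
      by (rule sum.cong) (simp_all only: step atLeastAtMost_iff)
    also have "\<dots> = sin (real k * u)" using IH by (simp only: mult[symmetric] one mult_1_right)
    finally have "sin (real k * u) =
        (\<Sum>r = 0..2 * (m + 1). lam \<alpha> (m + 1) k r * B_fun \<alpha> (m + 1) r u)" ..
    moreover
    have "(\<Sum>r = 0..2 * (m + 1). mu \<alpha> (m + 1) k r * B_fun \<alpha> (m + 1) r u) =
        (\<Sum>r = 0..2 * (m + 1). B_conv \<alpha> m (mu \<alpha> m k) (\<lambda>_. 1) r * B_fun \<alpha> (m + 1) r u)"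
      by (rule sum.cong) (simp_all only: step atLeastAtMost_iff)
    then have "cos (real k * u) =
        (\<Sum>r = 0..2 * (m + 1). mu \<alpha> (m + 1) k r * B_fun \<alpha> (m + 1) r u)"
      using IH by (simp only: mult[symmetric] one mult_1_right)
    ultimately show ?thesis by (simp only: Suc_eq_plus1)
  next
    case False
    then have k: "k = m + 1" using Suc.prems by simp
    note step = lam_mu_step_top[OF assms(1,2) Suc.hyps]
    note IH = Suc.IH[OF Suc.hyps order.refl] and base = trig_expansion_1[OF assms(1,2), of u]
    have angle: "real k * u = real m * u + u" by (simp add: k distrib_right)
    have "(\<Sum>r = 0..2 * (m + 1). lam \<alpha> (m + 1) (m + 1) r * B_fun \<alpha> (m + 1) r u) =
        (\<Sum>r = 0..2 * (m + 1). B_conv \<alpha> m (lam \<alpha> m m) (mu \<alpha> 1 1) r * B_fun \<alpha> (m + 1) r u +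
          B_conv \<alpha> m (mu \<alpha> m m) (lam \<alpha> 1 1) r * B_fun \<alpha> (m + 1) r u)"
      by (rule sum.cong) (simp_all only: step atLeastAtMost_iff distrib_right)
    then have "sin (real k * u) =
        (\<Sum>r = 0..2 * (m + 1). lam \<alpha> (m + 1) (m + 1) r * B_fun \<alpha> (m + 1) r u)"
      using IH base by (simp only: angle sin_add sum.distrib mult[symmetric])
    moreover
    have "(\<Sum>r = 0..2 * (m + 1). mu \<alpha> (m + 1) (m + 1) r * B_fun \<alpha> (m + 1) r u) =
        (\<Sum>r = 0..2 * (m + 1). B_conv \<alpha> m (mu \<alpha> m m) (mu \<alpha> 1 1) r * B_fun \<alpha> (m + 1) r u -
          B_conv \<alpha> m (lam \<alpha> m m) (lam \<alpha> 1 1) r * B_fun \<alpha> (m + 1) r u)"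
      by (rule sum.cong) (simp_all only: step atLeastAtMost_iff left_diff_distrib)
    then have "cos (real k * u) =
        (\<Sum>r = 0..2 * (m + 1). mu \<alpha> (m + 1) (m + 1) r * B_fun \<alpha> (m + 1) r u)"
      using IH base by (simp only: angle cos_add sum_subtractf mult[symmetric])
    ultimately show ?thesis by (simp only: Suc_eq_plus1 k)
  qed
qed

lemma trig_vec_eq_trafo_mat_mult:
  assumes "0 < \<alpha>" "\<alpha> < pi" "m \<ge> 1"
  shows "trig_vec m u = trafo_mat \<alpha> m *\<^sub>v B_vec \<alpha> m u"
proof (rule eq_vecI)
  show "dim_vec (trig_vec m u) = dim_vec (trafo_mat \<alpha> m *\<^sub>v B_vec \<alpha> m u)"
    by (simp add: trig_vec_def trafo_mat_def)
next
  fix i assume "i < dim_vec (trafo_mat \<alpha> m *\<^sub>v B_vec \<alpha> m u)"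
  then have i: "i < 2 * m + 1" by (simp add: trafo_mat_def)
  have range: "{0..<2 * m + 1} = {0..2 * m}" by auto
  have row: "(trafo_mat \<alpha> m *\<^sub>v B_vec \<alpha> m u) $ i =
      (\<Sum>r = 0..2 * m. trafo_mat \<alpha> m $$ (i, r) * B_fun \<alpha> m r u)"
    using i by (simp add: trafo_mat_def B_vec_def scalar_prod_def flip: range)
  consider "i = 0" | "odd i" | "i \<noteq> 0" "even i" by blast
  then show "trig_vec m u $ i = (trafo_mat \<alpha> m *\<^sub>v B_vec \<alpha> m u) $ i"
  proof cases
    case 1
    then show ?thesis unfolding row
      using B_fun_sum_eq_1[OF assms(1,2), of m u] by (simp add: trig_vec_def trafo_mat_def)
  next
    case 2
    then have "i \<noteq> 0" "1 \<le> (i + 1) div 2" "(i + 1) div 2 \<le> m" using i by (auto elim!: oddE)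
    then show ?thesis unfolding row
      using 2 i trig_expansion[OF assms, of "(i + 1) div 2" u]
      by (simp add: trig_vec_def trafo_mat_def)
  next
    case 3
    then have "1 \<le> i div 2" "i div 2 \<le> m" using i by (auto elim!: evenE)
    then show ?thesis unfolding row
      using 3 i trig_expansion[OF assms, of "i div 2" u]
      by (simp add: trig_vec_def trafo_mat_def)
  qed
qed

theorem theorem4p1:
  fixes \<alpha> :: real and n :: nat
  assumes "0 < \<alpha>" and "\<alpha> < pi" and "n \<ge> 1"
  shows "\<forall>u\<in>{0..\<alpha>}.
    trig_vec (n + 1) u = trafo_mat \<alpha> (n + 1) *\<^sub>v B_vec \<alpha> (n + 1) u \<and>
    1 = (\<Sum>r = 0..2 * (n + 1). B_fun \<alpha> (n + 1) r u) \<and>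
    (\<forall>k\<in>{1..n + 1}.
      sin (real k * u) = (\<Sum>r = 0..2 * (n + 1). lam \<alpha> (n + 1) k r * B_fun \<alpha> (n + 1) r u) \<and>
      cos (real k * u) = (\<Sum>r = 0..2 * (n + 1). mu \<alpha> (n + 1) k r * B_fun \<alpha> (n + 1) r u))"
proof (intro ballI conjI)
  have n: "n + 1 \<ge> 1" by simp
  fix u
  show "trig_vec (n + 1) u = trafo_mat \<alpha> (n + 1) *\<^sub>v B_vec \<alpha> (n + 1) u"
    by (rule trig_vec_eq_trafo_mat_mult[OF assms(1,2) n])
  show "1 = (\<Sum>r = 0..2 * (n + 1). B_fun \<alpha> (n + 1) r u)"
    using B_fun_sum_eq_1[OF assms(1,2)] by (rule sym)
  fix k assume "k \<in> {1..n + 1}"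
  then have k: "1 \<le> k" "k \<le> n + 1" by auto
  show "sin (real k * u) = (\<Sum>r = 0..2 * (n + 1). lam \<alpha> (n + 1) k r * B_fun \<alpha> (n + 1) r u)"
    using trig_expansion[OF assms(1,2) n k] by (rule conjunct1)
  show "cos (real k * u) = (\<Sum>r = 0..2 * (n + 1). mu \<alpha> (n + 1) k r * B_fun \<alpha> (n + 1) r u)"
    using trig_expansion[OF assms(1,2) n k] by (rule conjunct2)
qed

end
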